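(* Let $X\subseteq\mathbb{R}^n$ be a nonempty open set, $C\subseteq\mathbb{R}^m$ a closed pointed convex cone with nonempty interior, $f:X\to\mathbb{R}^m$ locally Lipschitz, $\eta:X\times X\to\mathbb{R}^n$ a mapping, and $e\in\mathbb{R}^m$ with $e>_C 0$. Let $\xi\in X$ and suppose that $-f$ is approximate $(\eta,e)$-invex at $\xi$ and that $\eta(x,\xi)+\eta(\xi,x)=0$ for all $x\in X$. If $\xi$ is a solution of (MVVI), then $\xi$ is a local $(\eta,e)$-quasi efficient solution of the vector optimization problem (VOP) $\min_{x\in X} f(x)$.
   Context: Ordering: for $u,v\in\mathbb{R}^m$, $u\ge_C v$ (equivalently $v\le_C u$) means $u-v\in C$, and $u>_C v$ (equivalently $v<_C u$) means $u-v\in\operatorname{int} C$. $B(x_0,r)$ is the open ball of center $x_0$ and radius $r$; only points of $X$ are considered, since $f$ and $\eta$ are defined on $X$ and $X\times X$. Clarke's generalized Jacobian of a locally Lipschitz $g:X\to\mathbb{R}^m$ at $x\in X$ is the set of $m\times n$ matrices $\partial g(x)=\operatorname{co}\{\lim_{i\to\infty} Jg(x^{(i)}) : x^{(i)}\to x,\ x^{(i)}\in S\}$, where $\operatorname{co}$ is the convex hull, $S$ is the set of points at which $g$ is differentiable, and $Jg$ is the Jacobian matrix (the limits being those that exist). Approximate $(\eta,e)$-invexity: a locally Lipschitz $g:X\to\mathbb{R}^m$ is approximate $(\eta,e)$-invex at $x_0\in X$ if there is $r>0$ such that for all $x,y\in B(x_0,r)$, $g(x)-g(y)\ge_C A_y\,\eta(x,y)-e\,\|\eta(x,y)\|$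 for all $A_y\in\partial g(y)$. (MVVI): $\xi\in X$ is a solution of (MVVI) if there is no $x\in X\setminus\{\xi\}$ such that $A_x\,\eta(x,\xi)\le_C 0$ for all $A_x\in\partial f(x)$. Local $(\eta,e)$-quasi efficient solution: $\xi\in X$ is such a solution of (VOP) if there is $r>0$ such that there is no $x\in B(\xi,r)\setminus\{\xi\}$ satisfying $f(x)+e\,\|\eta(x,\xi)\|\le_C f(\xi)$. *)

theory Defs
  imports "HOL-Analysis.Analysis"
begin

(* Functions on X (or on X \<times> X) are total functions; every notion below
   only looks at their values at points of X. *)

definition pointed_cone :: "'a::real_vector set \<Rightarrow> bool" where
  "pointed_cone C \<longleftrightarrow> C \<inter> uminus ` C = {0}"

definition cone_le :: "'a::real_vector set \<Rightarrow> 'a \<Rightarrow> 'a \<Rightarrow> bool" where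
  "cone_le C v u \<longleftrightarrow> u - v \<in> C"

definition cone_less :: "'a::real_normed_vector set \<Rightarrow> 'a \<Rightarrow> 'a \<Rightarrow> bool" where
  "cone_less C v u \<longleftrightarrow> u - v \<in> interior C"

definition locally_lipschitz_on :: "'a::metric_space set \<Rightarrow> ('a \<Rightarrow> 'b::metric_space) \<Rightarrow> bool" where
  "locally_lipschitz_on X g \<longleftrightarrow>
     (\<forall>x\<in>X. \<exists>u>0. \<exists>L. L-lipschitz_on (ball x u \<inter> X) g)"

(* Clarke's generalized Jacobian. It is meant for open X, where
   differentiability at y \<in> X depends only on the values of g on X. *)
definition clarke_jacobian ::
  "(real ^ 'n) set \<Rightarrow> (real ^ 'n \<Rightarrow> real ^ 'm) \<Rightarrow> real ^ 'n \<Rightarrow> (real ^ 'n ^ 'm) set" where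
  "clarke_jacobian X g x =
     convex hull {A. \<exists>s :: nat \<Rightarrow> real ^ 'n.
       (\<forall>i. s i \<in> X \<and> g differentiable (at (s i))) \<and>
       s \<longlonglongrightarrow> x \<and> (\<lambda>i. jacobian g (at (s i))) \<longlonglongrightarrow> A}"

(* To be used for g that is locally Lipschitz on X and x0 \<in> X. *)
definition approx_invex_at ::
  "(real ^ 'n) set \<Rightarrow> (real ^ 'm) set \<Rightarrow> (real ^ 'n \<Rightarrow> real ^ 'n \<Rightarrow> real ^ 'n) \<Rightarrow> real ^ 'm
    \<Rightarrow> (real ^ 'n \<Rightarrow> real ^ 'm) \<Rightarrow> real ^ 'n \<Rightarrow> bool" where
  "approx_invex_at X C \<eta> e g x0 \<longleftrightarrow>
     (\<exists>r>0. \<forall>x \<in> X \<inter> ball x0 r. \<forall>y \<in> X \<inter> ball x0 r. \<forall>A \<in> clarke_jacobian X g y.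
        cone_le C (A *v \<eta> x y - norm (\<eta> x y) *\<^sub>R e) (g x - g y))"

definition MVVI_solution ::
  "(real ^ 'n) set \<Rightarrow> (real ^ 'm) set \<Rightarrow> (real ^ 'n \<Rightarrow> real ^ 'n \<Rightarrow> real ^ 'n)
    \<Rightarrow> (real ^ 'n \<Rightarrow> real ^ 'm) \<Rightarrow> real ^ 'n \<Rightarrow> bool" where
  "MVVI_solution X C \<eta> f \<xi> \<longleftrightarrow> \<xi> \<in> X \<and>
     \<not> (\<exists>x \<in> X - {\<xi>}. \<forall>A \<in> clarke_jacobian X f x. cone_le C (A *v \<eta> x \<xi>) 0)"

definition local_quasi_efficient ::
  "(real ^ 'n) set \<Rightarrow> (real ^ 'm) set \<Rightarrow> (real ^ 'n \<Rightarrow> real ^ 'n \<Rightarrow> real ^ 'n) \<Rightarrow> real ^ 'm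
    \<Rightarrow> (real ^ 'n \<Rightarrow> real ^ 'm) \<Rightarrow> real ^ 'n \<Rightarrow> bool" where
  "local_quasi_efficient X C \<eta> e f \<xi> \<longleftrightarrow> \<xi> \<in> X \<and>
     (\<exists>r>0. \<not> (\<exists>x \<in> (X \<inter> ball \<xi> r) - {\<xi>}.
        cone_le C (f x + norm (\<eta> x \<xi>) *\<^sub>R e) (f \<xi>)))"

end

theory Submission
  imports Defs
begin

text \<open>
  The argument is by contradiction. Let \<open>r\<close> be a radius from the approximate invexity of \<open>- f\<close>
  at \<open>\<xi>\<close>, and let \<open>x \<noteq> \<xi>\<close> in \<open>X \<inter> ball \<xi> r\<close> violate quasi efficiency, so that \<open>C\<close> contains
  \<open>f \<xi> - f x - \<parallel>\<eta> x \<xi>\<parallel> e\<close>. Invexity of \<open>- f\<close> is used for the pair \<open>(\<xi>, x)\<close>, that is, with the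
  generalized Jacobian taken at the violating point \<open>x\<close>. Its matrices are the \<open>- A\<close> with \<open>A\<close> in
  the generalized Jacobian of \<open>f\<close> (\<open>clarke_jacobian_minus\<close>), and skew-symmetry gives
  \<open>\<eta> \<xi> x = - \<eta> x \<xi>\<close>. The two signs cancel, hence \<open>C\<close> contains
  \<open>- f \<xi> + f x - A (\<eta> x \<xi>) + \<parallel>\<eta> x \<xi>\<parallel> e\<close>. In the sum of the two elements of \<open>C\<close> the values of
  \<open>f\<close> and the terms with \<open>e\<close> cancel, which leaves \<open>- A (\<eta> x \<xi>) \<in> C\<close>. This holds for every such
  \<open>A\<close>, so \<open>x\<close> is exactly what a solution of the Minty variational inequality forbids.
\<close>

lemma jacobian_minus:
  fixes g :: "real ^ 'n \<Rightarrow> real ^ 'm"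
  assumes "g differentiable (at y)"
  shows "jacobian (\<lambda>x. - g x) (at y) = - jacobian g (at y)"
proof -
  have "frechet_derivative (\<lambda>x. - g x) (at y) = (\<lambda>h. - frechet_derivative g (at y) h)"
    using assms has_derivative_minus frechet_derivative_at frechet_derivative_works by metis
  then show ?thesis
    by (simp add: jacobian_def matrix_def vec_eq_iff)
qed

text \<open>
  Negation acts on each Jacobian along an approximating sequence, hence on the limits, and being
  linear it commutes with the convex hull.
\<close>

lemma clarke_jacobian_minus:
  fixes g :: "real ^ 'n \<Rightarrow> real ^ 'm"
  assumes "A \<in> clarke_jacobian X g x"
  shows "- A \<in> clarke_jacobian X (\<lambda>x. - g x) x"
proof -
  define L :: "(real ^ 'n \<Rightarrow> real ^ 'm) \<Rightarrow> (real ^ 'n ^ 'm) set" where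
    "L h = {A. \<exists>s :: nat \<Rightarrow> real ^ 'n.
       (\<forall>i. s i \<in> X \<and> h differentiable (at (s i))) \<and>
       s \<longlonglongrightarrow> x \<and> (\<lambda>i. jacobian h (at (s i))) \<longlonglongrightarrow> A}" for h
  have "- B \<in> L (\<lambda>x. - g x)" if B: "B \<in> L g" for B
  proof -
    obtain s where s: "\<And>i. s i \<in> X" "\<And>i. g differentiable (at (s i))" "s \<longlonglongrightarrow> x"
      and lim: "(\<lambda>i. jacobian g (at (s i))) \<longlonglongrightarrow> B"
      using B unfolding L_def by blast
    have "(\<lambda>i. jacobian (\<lambda>x. - g x) (at (s i))) \<longlonglongrightarrow> - B"
      using tendsto_minus[OF lim] s(2) by (simp add: jacobian_minus)
    then show ?thesis
      using s by (auto simp: L_def intro!: exI[of _ s] differentiable_minus)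
  qed
  then have "uminus ` L g \<subseteq> L (\<lambda>x. - g x)"
    by blast
  moreover have "uminus ` (convex hull L g) = convex hull (uminus ` L g)"
    by (intro convex_hull_linear_image linear_uminus)
  ultimately have "uminus ` (convex hull L g) \<subseteq> convex hull L (\<lambda>x. - g x)"
    by (simp add: hull_mono)
  then show ?thesis
    using assms unfolding clarke_jacobian_def L_def by blast
qed

theorem theorem3p3:
  fixes X :: "(real ^ 'n) set"
    and C :: "(real ^ 'm) set"
    and f :: "real ^ 'n \<Rightarrow> real ^ 'm"
    and \<eta> :: "real ^ 'n \<Rightarrow> real ^ 'n \<Rightarrow> real ^ 'n"
    and e :: "real ^ 'm"
    and \<xi> :: "real ^ 'n"
  assumes "X \<noteq> {}" and "open X"
    and "closed C" and "convex_cone C" and "pointed_cone C" and "interior C \<noteq> {}"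
    and "locally_lipschitz_on X f"
    and "cone_less C 0 e"
    and "\<xi> \<in> X"
    and "approx_invex_at X C \<eta> e (\<lambda>x. - f x) \<xi>"
    and "\<And>x. x \<in> X \<Longrightarrow> \<eta> x \<xi> + \<eta> \<xi> x = 0"
    and "MVVI_solution X C \<eta> f \<xi>"
  shows "local_quasi_efficient X C \<eta> e f \<xi>"
proof -
  obtain r where "r > 0" and invex:
    "\<And>x y A. \<lbrakk>x \<in> X \<inter> ball \<xi> r; y \<in> X \<inter> ball \<xi> r; A \<in> clarke_jacobian X (\<lambda>x. - f x) y\<rbrakk>
      \<Longrightarrow> cone_le C (A *v \<eta> x y - norm (\<eta> x y) *\<^sub>R e) (- f x - - f y)"
    using assms(10) unfolding approx_invex_at_def by blast
  have False
    if x: "x \<in> (X \<inter> ball \<xi> r) - {\<xi>}" and better: "cone_le C (f x + norm (\<eta> x \<xi>) *\<^sub>R e) (f \<xi>)"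
    for x
  proof -
    have skew: "\<eta> \<xi> x = - \<eta> x \<xi>"
      using assms(11)[of x] x by (simp add: eq_neg_iff_add_eq_0 add.commute)
    have "cone_le C (A *v \<eta> x \<xi>) 0" if A: "A \<in> clarke_jacobian X f x" for A
    proof -
      have mult: "(- A) *v \<eta> \<xi> x = A *v \<eta> x \<xi>"
        by (simp add: skew matrix_vector_mult_def vec_eq_iff)
      have "cone_le C ((- A) *v \<eta> \<xi> x - norm (\<eta> \<xi> x) *\<^sub>R e) (- f \<xi> - - f x)"
        using invex[OF _ _ clarke_jacobian_minus[OF A]] x \<open>\<xi> \<in> X\<close> \<open>r > 0\<close> by simp
      then have "- f \<xi> + f x - (A *v \<eta> x \<xi> - norm (\<eta> x \<xi>) *\<^sub>R e) \<in> C"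
        unfolding mult by (simp add: cone_le_def skew)
      moreover have "f \<xi> - (f x + norm (\<eta> x \<xi>) *\<^sub>R e) \<in> C"
        using better by (simp add: cone_le_def)
      ultimately have "(- f \<xi> + f x - (A *v \<eta> x \<xi> - norm (\<eta> x \<xi>) *\<^sub>R e))
          + (f \<xi> - (f x + norm (\<eta> x \<xi>) *\<^sub>R e)) \<in> C"
        using \<open>convex_cone C\<close> convex_cone_add by blast
      then show ?thesis
        by (simp add: cone_le_def algebra_simps)
    qed
    then show False
      using assms(12) x unfolding MVVI_solution_def by blast
  qed
  then show ?thesis
    using \<open>r > 0\<close> \<open>\<xi> \<in> X\<close> unfolding local_quasi_efficient_def by blast
qed

end
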